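(* Let $0 < q, r < \infty$ and $u, v, w \in \mathcal{W}(0,\infty)$. Assume that $\{x_k\}_{k \in \mathcal{Z}}$ is a covering sequence (associated with $u$). Then \begin{align*} \bigg( \int_0^{\infty} \bigg( \int_x^{\infty} \bigg( \int_0^t h \bigg)^q w(t)\,dt \bigg)^{\frac{r}{q}} u(x)\,dx \bigg)^{\frac{1}{r}} \approx {} & \bigg\| \bigg\{ 2^{\frac{k}{r}} \bigg( \int_{x_k}^{x_{k+1}} \bigg( \int_{x_k}^t h \bigg)^q w(t)\,dt \bigg)^{\frac{1}{q}} \bigg\} \bigg\|_{\ell^r(\mathcal{Z})} \\ & + \bigg( \int_0^{\infty} u(x) \bigg[ \sup_{s \in [x,\infty)} \bigg( \int_s^{\infty} w \bigg)^{\frac{1}{q}} \bigg( \int_0^s h\bigg) \bigg]^r \,dx \bigg)^{\frac{1}{r}} \end{align*} with equivalence constants independent of $h \in \mathfrak{M}^+(0,\infty)$.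
   Context: $\mathfrak{M}^+(0,\infty)$ is the set of all non-negative (Lebesgue) measurable functions on $(0,\infty)$. A weight is a function $v \in \mathfrak{M}^+(0,\infty)$ such that $0 < \int_0^x v(t)\,dt < \infty$ for all $x \in (0,\infty)$; $\mathcal{W}(0,\infty)$ is the set of all weights. Integrals without a displayed differential are Lebesgue integrals of the indicated function. Convention: $0\cdot\infty=0$. Covering sequence: let $u$ be a weight on $(0,\infty)$. If $\int_0^\infty u = \infty$, let $\mathcal{Z} = \mathbb{Z}$ and let $\{x_k\}_{k\in\mathbb{Z}} \subset (0,\infty)$ be a strictly increasing sequence such that $\int_0^{x_k} u(t)\,dt = 2^k$ for all $k \in \mathbb{Z}$. If $\int_0^\infty u < \infty$, let $M\in\mathbb{Z}$ satisfy $2^M \le \int_0^\infty u(t)\,dt < 2^{M+1}$, let $\mathcal{Z} = \{k \in \mathbb{Z} : k \le M\}$, let $\{x_k\}_{k=-\infty}^{M}$ be a strictly increasing sequence such that $\int_0^{x_k} u(t)\,dt = 2^k$ for $-\infty<k \le M$, and put $x_{M+1} := \infty$. In both cases $\bigcup_{k\in\mathcal{Z}} [x_k,x_{k+1}) = (0,\infty)$, and $\{x_k\}_{k \in \mathcal{Z}}$ is called a covering sequence. For $0<r<\infty$, $\|\{a_k\}\|_{\ell^r(\mathcal{Z})} = \big(\sum_{k\in\mathcal{Z}} |a_k|^r\big)^{1/r}$. $A \approx B$ means $\lambda^{-1}A \le B \le \lambda A$ for a constant $\lambda \in (0,\infty)$ depending only on the parameters $q,r$. *)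

theory Defs
  imports "HOL-Analysis.Analysis"
begin

(* Non-negative functions are [0,\<infinity>]-valued, so that 0 * \<infinity> = 0 holds by the arithmetic of ennreal.
   A function on (0,\<infinity>) is represented by a function on the reals whose values outside (0,\<infinity>)
   are never inspected. *)

definition nonneg_measurable :: "(real \<Rightarrow> ennreal) set" where
  "nonneg_measurable = borel_measurable (lebesgue_on {0<..})"

definition weights :: "(real \<Rightarrow> ennreal) set" where
  "weights = {v \<in> nonneg_measurable.
     \<forall>x>0. 0 < (\<integral>\<^sup>+t\<in>{0<..<x}. v t \<partial>lebesgue) \<and> (\<integral>\<^sup>+t\<in>{0<..<x}. v t \<partial>lebesgue) < \<infinity>}"

(* Only meant for exponents p > 0, where \<infinity> to the power p is \<infinity> and 0 to the power p is 0. *)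
definition epowr :: "ennreal \<Rightarrow> real \<Rightarrow> ennreal"  (infixr "epowr" 80) where
  "a epowr p = (if a = \<infinity> then \<infinity> else ennreal (enn2real a powr p))"

definition lr_norm :: "real \<Rightarrow> int set \<Rightarrow> (int \<Rightarrow> ennreal) \<Rightarrow> ennreal" where
  "lr_norm r Z a = (\<Sum>\<^sub>\<infinity>k\<in>Z. a k epowr r) epowr (1 / r)"

(* The points are extended reals because x (M + 1) = \<infinity> when u is integrable. If moreover the
   total integral of u equals 2^M exactly, then the last point x M may itself be \<infinity>; in general
   no finite x M with the required integral exists in that case. All other points are finite
   by strict monotonicity. Values of x at other indices outside Z are irrelevant. *)
definition covering_sequence :: "(real \<Rightarrow> ennreal) \<Rightarrow> int set \<Rightarrow> (int \<Rightarrow> ereal) \<Rightarrow> bool" where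
  "covering_sequence u Z x \<longleftrightarrow>
     strict_mono_on Z x \<and>
     (\<forall>k\<in>Z. 0 < x k \<and> (\<integral>\<^sup>+t\<in>einterval 0 (x k). u t \<partial>lebesgue) = ennreal (2 powi k)) \<and>
     (if (\<integral>\<^sup>+t\<in>{0<..}. u t \<partial>lebesgue) = \<infinity>
      then Z = UNIV \<and> (\<forall>k. x k < \<infinity>)
      else (\<exists>M. ennreal (2 powi M) \<le> (\<integral>\<^sup>+t\<in>{0<..}. u t \<partial>lebesgue) \<and>
                (\<integral>\<^sup>+t\<in>{0<..}. u t \<partial>lebesgue) < ennreal (2 powi (M + 1)) \<and>
                Z = {..M} \<and> x (M + 1) = \<infinity>))"

definition equivalent_with :: "real \<Rightarrow> ennreal \<Rightarrow> ennreal \<Rightarrow> bool" where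
  "equivalent_with c A B \<longleftrightarrow> ennreal (1 / c) * A \<le> B \<and> B \<le> ennreal c * A"

end

theory Submission
  imports Defs
begin

text \<open>
  Write \<open>H t\<close> for the integral of \<open>h\<close> over \<open>(0, t)\<close>, \<open>W s\<close> for the integral of \<open>w\<close> over
  \<open>(s, \<infinity>)\<close>, \<open>F y\<close> for the integral of \<open>H\<^sup>q w\<close> over \<open>(y, \<infinity>)\<close> and \<open>G y\<close> for the
  supremum over \<open>s \<ge> y\<close> of \<open>W(s)\<^bsup>1/q\<^esup> H(s)\<close>. After raising to the power \<open>r\<close>, the claim
  compares the integral of \<open>F\<^bsup>r/q\<^esup> u\<close> with the integral of \<open>G\<^sup>r u\<close> and the sum of
  \<open>2\<^sup>k A\<^sub>k\<^bsup>r/q\<^esup>\<close>, where \<open>A\<^sub>k\<close> is the contribution of the cell \<open>(x\<^sub>k, x\<^sub>k\<^sub>+\<^sub>1)\<close> that involves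
  only the values of \<open>h\<close> and \<open>w\<close> in this cell.

  Both \<open>F\<close> and \<open>G\<close> are nonincreasing, and up to a factor \<open>2\<close> a nonincreasing \<open>\<phi>\<close> has the
  same integral for the measure \<open>u dy\<close> and for point masses \<open>2\<^sup>k\<close> at the nodes: the cell to the
  right of \<open>x\<^sub>k\<close> has \<open>u\<close>-mass at most \<open>2\<^sup>k\<close>, the cell to its left has \<open>u\<close>-mass exactly
  \<open>2\<^sup>k / 2\<close>. This is the content of \<open>discretize_upper\<close> and \<open>discretize_lower\<close>, and it
  reduces everything to the values at the nodes.

  The right-hand side is dominated by the left-hand side because \<open>G(y)\<^sup>q \<le> F(y)\<close> and
  \<open>A\<^sub>k \<le> F(x\<^sub>k)\<close>, both by monotonicity of \<open>H\<close>. For the converse, \<open>F(x\<^sub>k)\<close> is the sum over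
  \<open>j \<ge> k\<close> of the integrals of \<open>H\<^sup>q w\<close> over the cells. In the cell number \<open>j\<close> one splits
  \<open>H(t)\<close> into \<open>H(x\<^sub>j)\<close> and the integral of \<open>h\<close> over \<open>(x\<^sub>j, t)\<close>. The second part produces \<open>A\<^sub>j\<close>,
  and the first one at most \<open>H(x\<^sub>j)\<^sup>q W(x\<^sub>j) \<le> G(x\<^sub>j)\<^sup>q\<close> (\<open>F_local_le\<close>). The weights \<open>2\<^sup>k\<close>
  grow geometrically, so a Hardy inequality (\<open>geometric_hardy_inequality\<close>) replaces the tail
  sums over \<open>j \<ge> k\<close> by their first terms, and only \<open>A\<^sub>k\<close> and \<open>G(x\<^sub>k)\<close> remain.
\<close>

section \<open>Real powers of extended nonnegative numbers\<close>

lemma epowr_ennreal: "0 \<le> x \<Longrightarrow> ennreal x epowr p = ennreal (x powr p)"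
  by (simp add: epowr_def)

lemma epowr_zero [simp]: "0 epowr p = 0"
  using epowr_ennreal[of 0 p] by simp

lemma epowr_top [simp]: "top epowr p = top"
  by (simp add: epowr_def)

lemma epowr_mono: "a \<le> b \<Longrightarrow> 0 \<le> p \<Longrightarrow> a epowr p \<le> b epowr p"
  by (cases a; cases b) (auto simp: epowr_ennreal top_unique intro!: ennreal_leI powr_mono2)

lemma epowr_mult: "(a * b) epowr p = a epowr p * b epowr p"
proof -
  have top: "(top * c) epowr p = top * c epowr p" for c
  proof (cases c)
    case (real r)
    then show ?thesis
      by (cases "r = 0") (simp_all add: epowr_ennreal ennreal_top_mult)
  qed simp
  show ?thesis
  proof (cases "a = top \<or> b = top")
    case True
    then show ?thesis
      using top[of a] top[of b] by (auto simp: mult.commute)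
  next
    case False
    then obtain x y where "a = ennreal x" "b = ennreal y" "0 \<le> x" "0 \<le> y"
      by (metis ennreal_cases)
    then show ?thesis
      by (simp add: epowr_ennreal ennreal_mult[symmetric] powr_mult)
  qed
qed

lemma epowr_epowr: "(a epowr p) epowr s = a epowr (p * s)"
  by (cases a) (auto simp: epowr_ennreal powr_powr)

lemma epowr_one [simp]: "a epowr 1 = a"
  by (cases a) (auto simp: epowr_ennreal)

lemma epowr_inverse: "p \<noteq> 0 \<Longrightarrow> (a epowr (1 / p)) epowr p = a" "p \<noteq> 0 \<Longrightarrow> (a epowr p) epowr (1 / p) = a"
  by (simp_all add: epowr_epowr)

text \<open>
  The sum is at most twice the larger term. The constant is not sharp, but it serves
  convex and concave powers alike.
\<close>

lemma epowr_add_le: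
  assumes "0 \<le> p"
  shows "(a + b) epowr p \<le> ennreal (2 powr p) * (a epowr p + b epowr p)"
proof -
  have "(a + b) epowr p \<le> (ennreal 2 * max a b) epowr p"
    using assms by (intro epowr_mono) (auto simp: mult_2 intro!: add_mono)
  also have "\<dots> = ennreal (2 powr p) * max a b epowr p"
    unfolding epowr_mult by (subst epowr_ennreal) auto
  also have "\<dots> \<le> ennreal (2 powr p) * (a epowr p + b epowr p)"
    by (intro mult_left_mono) (auto simp: max_def)
  finally show ?thesis .
qed

lemma epowr_measurable [measurable (raw)]:
  assumes [measurable]: "f \<in> borel_measurable M"
  shows "(\<lambda>x. f x epowr p) \<in> borel_measurable M"
proof -
  have [measurable]: "{x \<in> space M. f x = \<infinity>} \<in> sets M"
    by (rule borel_measurable_eq) simp_all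
  show ?thesis
    unfolding epowr_def by (intro measurable_If) simp_all
qed

section \<open>Measurability and additivity on the half-line\<close>

text \<open>
  The superlevel sets are intervals.
\<close>

lemma borel_measurable_real_monotone:
  fixes f :: "real \<Rightarrow> 'a::{linorder_topology, second_countable_topology}"
  assumes "mono f \<or> antimono f"
  shows "f \<in> borel_measurable borel"
proof (rule borel_measurableI_greater)
  fix y
  have "is_interval {x. y < f x}"
    unfolding is_interval_1 using assms
    by (auto simp: monotone_def) (meson less_le_trans)+
  then show "{x \<in> space borel. y < f x} \<in> sets borel"
    by (simp add: real_interval_borel_measurable)
qed

text \<open>
  A member of \<^const>\<open>nonneg_measurable\<close> may be arbitrary on the negative half-line, so it is
  Lebesgue measurable only after multiplication by an indicator supported in \<open>(0, \<infinity>)\<close>.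
\<close>

lemma nonneg_measurable_indicator:
  assumes "f \<in> nonneg_measurable" "A \<in> sets lebesgue" "A \<subseteq> {0<..}"
  shows "(\<lambda>t. f t * indicator A t) \<in> borel_measurable lebesgue"
proof -
  have "(\<lambda>t. f t * indicator {0<..} t) \<in> borel_measurable lebesgue"
    using assms(1) by (simp add: nonneg_measurable_def borel_measurable_restrict_space_iff_ennreal)
  then have "(\<lambda>t. f t * indicator {0<..} t * indicator A t) \<in> borel_measurable lebesgue"
    using assms(2) by measurable
  also have "(\<lambda>t. f t * indicator {0<..} t * indicator A t) = (\<lambda>t. f t * indicator A t)"
    using assms(3) by (auto simp: fun_eq_iff split: split_indicator)
  finally show ?thesis .
qed

lemma nonneg_measurable_mult:
  assumes "f \<in> nonneg_measurable" "g \<in> nonneg_measurable"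
  shows "(\<lambda>t. f t * g t) \<in> nonneg_measurable"
  using assms unfolding nonneg_measurable_def by measurable

lemma nonneg_measurable_epowr:
  assumes "f \<in> nonneg_measurable"
  shows "(\<lambda>t. f t epowr p) \<in> nonneg_measurable"
  using assms unfolding nonneg_measurable_def by measurable

lemma nonneg_measurable_monotone:
  assumes "mono f \<or> antimono f"
  shows "f \<in> nonneg_measurable"
proof -
  have "f \<in> borel_measurable lborel"
    using borel_measurable_real_monotone[OF assms] by simp
  then show ?thesis
    unfolding nonneg_measurable_def by (intro measurable_restrict_space1 measurable_completion)
qed

lemma sets_lebesgue_einterval [measurable, simp]: "einterval a b \<in> sets lebesgue"
  using borel_einterval by (simp add: sets_completionI_sets)

lemma AE_lebesgue_countable:
  fixes C :: "real set"
  assumes "countable C"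
  shows "AE t in lebesgue. t \<notin> C"
  using AE_not_in[OF countable_imp_null_set_lborel[OF assms]] by (rule AE_completion)

text \<open>
  Additivity over adjacent open intervals. Both the mass of a cell and the splitting of the
  primitive of a function at a node are instances.
\<close>

lemma nn_integral_einterval_split:
  assumes f: "f \<in> nonneg_measurable" and "0 \<le> a" "a \<le> b"
  shows "(\<integral>\<^sup>+t\<in>einterval 0 b. f t \<partial>lebesgue)
    = (\<integral>\<^sup>+t\<in>einterval 0 a. f t \<partial>lebesgue) + (\<integral>\<^sup>+t\<in>einterval a b. f t \<partial>lebesgue)"
proof -
  have sub: "einterval 0 a \<subseteq> {0<..}" "einterval a b \<subseteq> {0<..}"
    using assms by (auto simp: einterval_iff dest: le_less_trans)
  have "(\<integral>\<^sup>+t\<in>einterval 0 b. f t \<partial>lebesgue)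
    = (\<integral>\<^sup>+t. f t * indicator (einterval 0 a) t + f t * indicator (einterval a b) t \<partial>lebesgue)"
  proof (rule nn_integral_cong_AE)
    \<comment> \<open>The common endpoint belongs to neither interval, and it is the only point where the two sides differ.\<close>
    have "AE t in lebesgue. t \<notin> {real_of_ereal a}"
      by (rule AE_lebesgue_countable) simp
    then show "AE t in lebesgue. f t * indicator (einterval 0 b) t
      = f t * indicator (einterval 0 a) t + f t * indicator (einterval a b) t"
    proof eventually_elim
      case (elim t)
      then have "a \<noteq> ereal t" by auto
      moreover have "0 < ereal t" if "a < ereal t" using assms(2) that by (rule le_less_trans)
      ultimately show ?case
        using assms(2,3) by (auto simp: einterval_iff split: split_indicator)
    qed
  qed
  also have "\<dots> = (\<integral>\<^sup>+t\<in>einterval 0 a. f t \<partial>lebesgue) + (\<integral>\<^sup>+t\<in>einterval a b. f t \<partial>lebesgue)"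
    using sub by (intro nn_integral_add nonneg_measurable_indicator f) simp_all
  finally show ?thesis .
qed

lemma einterval_zero: "einterval 0 (ereal t) = {0<..<t}" "einterval 0 \<infinity> = {0<..}"
  by (auto simp: einterval_iff)

section \<open>Sums over the integers and a Hardy inequality with geometric weights\<close>

lemma nn_integral_int_shift:
  fixes f :: "int \<Rightarrow> ennreal"
  shows "(\<integral>\<^sup>+k. f (k + j) \<partial>count_space UNIV) = (\<integral>\<^sup>+k. f k \<partial>count_space UNIV)"
  by (rule nn_integral_bij_count_space[where g = "\<lambda>k. k + j"])
     (auto intro!: bij_betwI[where g = "\<lambda>k. k - j"])

lemma nn_integral_int_atLeast:
  fixes f :: "int \<Rightarrow> ennreal"
  shows "(\<integral>\<^sup>+j\<in>{k..}. f j \<partial>count_space UNIV) = (\<Sum>i. f (k + int i))"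
proof -
  have "(\<integral>\<^sup>+j\<in>{k..}. f j \<partial>count_space UNIV) = (\<integral>\<^sup>+j. f j \<partial>count_space {k..})"
    by (simp add: nn_integral_count_space_indicator)
  also have "\<dots> = (\<integral>\<^sup>+i. f (k + int i) \<partial>count_space UNIV)"
    by (rule nn_integral_bij_count_space[symmetric])
       (auto intro!: bij_betwI[where g = "\<lambda>j. nat (j - k)"])
  finally show ?thesis by (simp add: nn_integral_count_space_nat)
qed

text \<open>
  Sums written as integrals for the counting measure inherit linearity, monotonicity and the
  exchange with integrals from integration theory.
\<close>

lemma infsum_ennreal_int_eq_nn_integral:
  fixes f :: "int \<Rightarrow> ennreal"
  shows "infsum f Z = (\<integral>\<^sup>+k\<in>Z. f k \<partial>count_space UNIV)"
proof -
  \<comment> \<open>The finite sets exhaust the index set, so monotone convergence turns the integral into a supremum of finite sums.\<close>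
  define F where "F n = Z \<inter> {- int n..int n}" for n
  have fin: "finite (F n)" for n by (simp add: F_def)
  have sum_F: "(\<integral>\<^sup>+k. f k * indicator (F n) k \<partial>count_space UNIV) = sum f (F n)" for n
    using fin[of n] by (subst nn_integral_count_space'[of "F n"]) auto
  have "(\<integral>\<^sup>+k\<in>Z. f k \<partial>count_space UNIV) = (\<integral>\<^sup>+k. (SUP n. f k * indicator (F n) k) \<partial>count_space UNIV)"
  proof (intro nn_integral_cong antisym)
    fix k :: int
    have "f k * indicator Z k \<le> f k * indicator (F (nat \<bar>k\<bar>)) k"
      by (auto simp: F_def split: split_indicator)
    also have "\<dots> \<le> (SUP n. f k * indicator (F n) k)" by (rule SUP_upper) simp
    finally show "f k * indicator Z k \<le> (SUP n. f k * indicator (F n) k)" .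
  qed (auto intro!: SUP_least simp: F_def split: split_indicator)
  also have "\<dots> = (SUP n. \<integral>\<^sup>+k. f k * indicator (F n) k \<partial>count_space UNIV)"
    by (rule nn_integral_monotone_convergence_SUP)
       (auto simp: incseq_def le_fun_def F_def split: split_indicator)
  also have "\<dots> = (SUP n. sum f (F n))" by (simp only: sum_F)
  finally have upper: "(\<integral>\<^sup>+k\<in>Z. f k \<partial>count_space UNIV) = (SUP n. sum f (F n))" .
  have "infsum f Z = (SUP G\<in>{G. finite G \<and> G \<subseteq> Z}. sum f G)"
    by (rule nonneg_infsum_complete) simp
  also have "\<dots> = (\<integral>\<^sup>+k\<in>Z. f k \<partial>count_space UNIV)"
  proof (rule antisym)
    show "(SUP G\<in>{G. finite G \<and> G \<subseteq> Z}. sum f G) \<le> (\<integral>\<^sup>+k\<in>Z. f k \<partial>count_space UNIV)"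
    proof (rule SUP_least)
      fix G assume G: "G \<in> {G. finite G \<and> G \<subseteq> Z}"
      then have "sum f G = (\<integral>\<^sup>+k. f k * indicator G k \<partial>count_space UNIV)"
        by (subst nn_integral_count_space'[of G]) auto
      also have "\<dots> \<le> (\<integral>\<^sup>+k\<in>Z. f k \<partial>count_space UNIV)"
        using G by (intro nn_integral_mono) (auto split: split_indicator)
      finally show "sum f G \<le> (\<integral>\<^sup>+k\<in>Z. f k \<partial>count_space UNIV)" .
    qed
    show "(\<integral>\<^sup>+k\<in>Z. f k \<partial>count_space UNIV) \<le> (SUP G\<in>{G. finite G \<and> G \<subseteq> Z}. sum f G)"
      unfolding upper by (intro SUP_least SUP_upper) (auto simp: F_def)
  qed
  finally show ?thesis .
qed

text \<open>
  Summing the right-hand side of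
  \<open>(\<Sum>\<^sub>i b\<^sub>i)\<^sup>p \<le> S\<^sup>p \<Sum>\<^sub>i c\<^sup>i b\<^sub>i\<^sup>p\<close>, applied to \<open>b\<^sub>k\<^sub>+\<^sub>i\<close>, against \<open>2\<^sup>k\<close> and shifting \<open>k\<close> by \<open>i\<close>
  gives the factor \<open>\<Sum>\<^sub>i (c/2)\<^sup>i\<close>, which is finite for \<open>c < 2\<close>. The inequality itself holds for every
  \<open>c > 1\<close> and \<open>p > 0\<close>: each term \<open>c\<^sup>i b\<^sub>i\<^sup>p\<close> is at most the sum \<open>T\<close> of these
  terms, hence
  \<open>b\<^sub>i \<le> T\<^bsup>1/p\<^esup> d\<^sup>i\<close> with \<open>d = c\<^bsup>-1/p\<^esup> < 1\<close>, and the geometric series \<open>S = \<Sum>\<^sub>i d\<^sup>i\<close> converges. This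
  treats \<open>p \<le> 1\<close> and \<open>p > 1\<close> at once.
\<close>

lemma geometric_hardy_inequality:
  fixes p :: real
  assumes "0 < p"
  shows "\<exists>K>0. \<forall>b :: int \<Rightarrow> ennreal. (\<integral>\<^sup>+k. ennreal (2 powr k) * (\<Sum>i. b (k + int i)) epowr p \<partial>count_space UNIV)
       \<le> ennreal K * (\<integral>\<^sup>+k. ennreal (2 powr k) * b k epowr p \<partial>count_space UNIV)"
proof -
  \<comment> \<open>Any base strictly between 1 and 2 would do.\<close>
  define c d :: real where "c = 2 powr (1 / 2)" and "d = c powr (- 1 / p)"
  have c: "1 < c" "c < 2"
    using powr_less_mono[of "1/2" 1 "2::real"] by (auto simp: c_def)
  have d: "0 < d" "d < 1"
    using c assms by (auto simp: d_def powr_less_one)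
  define S where "S = 1 / (1 - d)"
  define R where "R = 1 / (1 - c / 2)"
  have S: "(\<Sum>i. ennreal (d ^ i)) = ennreal S" "0 < S"
    unfolding S_def using d by (auto simp: suminf_ennreal2 summable_geometric suminf_geometric)
  have R: "(\<Sum>i. ennreal ((c / 2) ^ i)) = ennreal R" "0 < R"
    unfolding R_def using c by (auto simp: suminf_ennreal2 summable_geometric suminf_geometric)
  have step: "(\<Sum>i. b i) epowr p \<le> ennreal (S powr p) * (\<Sum>i. ennreal (c ^ i) * b i epowr p)" for b :: "nat \<Rightarrow> ennreal"
  proof -
    define T where "T = (\<Sum>i. ennreal (c ^ i) * b i epowr p)"
    have "b i \<le> T epowr (1 / p) * ennreal (d ^ i)" for i
    proof -
      have dc: "ennreal (d ^ i) = ennreal (1 / c ^ i) epowr (1 / p)"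
        using c by (subst epowr_ennreal)
          (auto simp: d_def powr_power powr_realpow[symmetric] powr_powr powr_minus_divide[symmetric])
      have "ennreal (c ^ i) * b i epowr p \<le> T"
        unfolding T_def using sum_le_suminf[of "\<lambda>i. ennreal (c ^ i) * b i epowr p" "{i}"] by simp
      then have "ennreal (1 / c ^ i) * (ennreal (c ^ i) * b i epowr p) \<le> ennreal (1 / c ^ i) * T"
        by (rule mult_left_mono) simp
      then have "b i epowr p \<le> T * ennreal (1 / c ^ i)"
      proof -
        have "ennreal (1 / c ^ i) * ennreal (c ^ i) = 1"
          using c by (subst ennreal_mult[symmetric]) auto
        then show ?thesis
          using \<open>ennreal (1 / c ^ i) * (ennreal (c ^ i) * b i epowr p) \<le> ennreal (1 / c ^ i) * T\<close>
          by (metis mult.assoc mult.commute mult_1)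
      qed
      then have "(b i epowr p) epowr (1 / p) \<le> (T * ennreal (1 / c ^ i)) epowr (1 / p)"
        using assms by (intro epowr_mono) auto
      then show ?thesis using assms by (simp add: epowr_inverse epowr_mult dc)
    qed
    then have "(\<Sum>i. b i) \<le> (\<Sum>i. T epowr (1 / p) * ennreal (d ^ i))"
      by (intro suminf_le) auto
    also have "\<dots> = T epowr (1 / p) * ennreal S" by (simp add: S)
    finally have "(\<Sum>i. b i) epowr p \<le> (T epowr (1 / p) * ennreal S) epowr p"
      using assms by (intro epowr_mono) auto
    also have "\<dots> = ennreal (S powr p) * T"
      using assms S(2) by (simp add: epowr_mult epowr_inverse epowr_ennreal mult.commute)
    finally show ?thesis by (simp add: T_def)
  qed
  show ?thesis
  proof (intro exI conjI allI)
    show "0 < S powr p * R" using S R by simp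
    fix b :: "int \<Rightarrow> ennreal"
    define E where "E = (\<integral>\<^sup>+k. ennreal (2 powr k) * b k epowr p \<partial>count_space UNIV)"
    have shift: "(\<integral>\<^sup>+k. ennreal (2 powr k) * (ennreal (c ^ i) * b (k + int i) epowr p) \<partial>count_space UNIV)
      = ennreal ((c / 2) ^ i) * E" for i
    proof -
      have "(\<integral>\<^sup>+k. ennreal (2 powr k) * (ennreal (c ^ i) * b (k + int i) epowr p) \<partial>count_space UNIV)
        = (\<integral>\<^sup>+k. ennreal ((c / 2) ^ i) * (ennreal (2 powr (k + int i)) * b (k + int i) epowr p) \<partial>count_space UNIV)"
      proof (rule nn_integral_cong)
        fix k :: int
        have "2 powr k * c ^ i = (c / 2) ^ i * 2 powr (k + int i)"
          by (simp add: powr_add powr_realpow power_divide)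
        then have "ennreal (2 powr k) * ennreal (c ^ i) = ennreal ((c / 2) ^ i) * ennreal (2 powr (k + int i))"
          using c by (simp only: ennreal_mult[symmetric] powr_ge_zero zero_le_power divide_nonneg_nonneg)
        then show "ennreal (2 powr k) * (ennreal (c ^ i) * b (k + int i) epowr p)
          = ennreal ((c / 2) ^ i) * (ennreal (2 powr (k + int i)) * b (k + int i) epowr p)"
          by (metis mult.assoc)
      qed
      also have "\<dots> = ennreal ((c / 2) ^ i) * (\<integral>\<^sup>+k. ennreal (2 powr (k + int i)) * b (k + int i) epowr p \<partial>count_space UNIV)"
        by (rule nn_integral_cmult) simp
      also have "(\<integral>\<^sup>+k. ennreal (2 powr (k + int i)) * b (k + int i) epowr p \<partial>count_space UNIV) = E"
        unfolding E_def by (rule nn_integral_int_shift)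
      finally show ?thesis .
    qed
    have "(\<integral>\<^sup>+k. ennreal (2 powr k) * (\<Sum>i. b (k + int i)) epowr p \<partial>count_space UNIV)
      \<le> (\<integral>\<^sup>+k. ennreal (S powr p) * (\<Sum>i. ennreal (2 powr k) * (ennreal (c ^ i) * b (k + int i) epowr p)) \<partial>count_space UNIV)"
    proof (rule nn_integral_mono)
      fix k :: int
      have "ennreal (2 powr k) * (\<Sum>i. b (k + int i)) epowr p
        \<le> ennreal (2 powr k) * (ennreal (S powr p) * (\<Sum>i. ennreal (c ^ i) * b (k + int i) epowr p))"
        by (intro mult_left_mono step) simp
      then show "ennreal (2 powr k) * (\<Sum>i. b (k + int i)) epowr p
        \<le> ennreal (S powr p) * (\<Sum>i. ennreal (2 powr k) * (ennreal (c ^ i) * b (k + int i) epowr p))"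
        by (simp add: mult.left_commute[of "ennreal (2 powr k)" "ennreal (S powr p)"])
    qed
    also have "\<dots> = ennreal (S powr p) * (\<Sum>i. ennreal ((c / 2) ^ i) * E)"
      by (subst nn_integral_cmult, simp, subst nn_integral_suminf, simp, simp only: shift)
    also have "\<dots> = ennreal (S powr p * R) * E"
      using S R by (simp add: ennreal_mult mult.assoc)
    finally show "(\<integral>\<^sup>+k. ennreal (2 powr k) * (\<Sum>i. b (k + int i)) epowr p \<partial>count_space UNIV)
      \<le> ennreal (S powr p * R) * (\<integral>\<^sup>+k. ennreal (2 powr k) * b k epowr p \<partial>count_space UNIV)"
      by (simp add: E_def)
  qed
qed

section \<open>Cells of a covering sequence\<close>

locale covering =
  fixes u :: "real \<Rightarrow> ennreal" and Z :: "int set" and x :: "int \<Rightarrow> ereal"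
  assumes weight: "u \<in> weights" and covering: "covering_sequence u Z x"
begin

text \<open>
  If the total mass of \<open>u\<close> is exactly \<open>2\<^sup>M\<close>, the last node may be infinite. Its cell is then
  empty, and evaluating a function at this node would make no sense.
\<close>

definition finite_nodes :: "int set" where "finite_nodes = {k \<in> Z. x k < \<infinity>}"

definition node :: "int \<Rightarrow> real" where "node k = real_of_ereal (x k)"

definition cell :: "int \<Rightarrow> real set" where "cell k = einterval (x k) (x (k + 1))"

lemma u_measurable: "u \<in> nonneg_measurable"
  using weight by (simp add: weights_def)

lemma Z_downward:
  assumes "k \<in> Z" "j \<le> k"
  shows "j \<in> Z"
  using assms covering by (auto simp: covering_sequence_def split: if_splits)

lemma x_less:
  assumes "k \<in> Z" "j < k"
  shows "x j < x k"
  using assms covering Z_downward[of k j]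
  by (auto simp: covering_sequence_def strict_mono_on_def)

lemma x_pos: "k \<in> Z \<Longrightarrow> 0 < x k"
  using covering by (auto simp: covering_sequence_def)

lemma mass_below: "k \<in> Z \<Longrightarrow> (\<integral>\<^sup>+t\<in>einterval 0 (x k). u t \<partial>lebesgue) = ennreal (2 powr k)"
  using covering by (auto simp: covering_sequence_def powr_real_of_int')

lemma last_index:
  assumes "k \<in> Z" "k + 1 \<notin> Z"
  shows "x (k + 1) = \<infinity>" "(\<integral>\<^sup>+t\<in>{0<..}. u t \<partial>lebesgue) < ennreal (2 powr real_of_int (k + 1))"
proof -
  obtain M where M: "Z = {..M}" "x (M + 1) = \<infinity>"
    "(\<integral>\<^sup>+t\<in>{0<..}. u t \<partial>lebesgue) < ennreal (2 powi (M + 1))"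
    using covering assms(2) by (auto simp: covering_sequence_def split: if_splits)
  from M(1) assms have k: "k = M" by auto
  have "2 powr real_of_int (k + 1) = 2 powi (M + 1)"
    unfolding k by (rule powr_real_of_int') simp_all
  with M k show "x (k + 1) = \<infinity>" "(\<integral>\<^sup>+t\<in>{0<..}. u t \<partial>lebesgue) < ennreal (2 powr real_of_int (k + 1))"
    by simp_all
qed

text \<open>
  The nodes increase strictly, so every node with a successor index is finite.
\<close>

lemma finite_nodes_pred: "k \<in> Z \<Longrightarrow> k - 1 \<in> finite_nodes"
  using Z_downward[of k "k - 1"] x_less[of k "k - 1"] by (cases "x (k - 1)") (auto simp: finite_nodes_def)

lemma finite_nodes_subset: "k \<in> finite_nodes \<Longrightarrow> k \<in> Z"
  by (simp add: finite_nodes_def)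

lemma x_finite:
  assumes "k \<in> finite_nodes"
  shows "x k = ereal (node k)" "0 < node k"
proof -
  show "x k = ereal (node k)"
    using assms x_pos[of k] by (cases "x k") (auto simp: finite_nodes_def node_def)
  with x_pos[of k] assms show "0 < node k" by (auto simp: finite_nodes_def)
qed

lemma cell_pos: "k \<in> Z \<Longrightarrow> cell k \<subseteq> {0<..}"
  using x_pos[of k] by (auto simp: cell_def einterval_iff dest: less_trans)

lemma cell_empty: "k \<in> Z \<Longrightarrow> k \<notin> finite_nodes \<Longrightarrow> cell k = {}"
  by (auto simp: cell_def finite_nodes_def einterval_iff)

lemma cell_above: "k \<in> finite_nodes \<Longrightarrow> t \<in> cell k \<Longrightarrow> node k < t"
  by (auto simp: cell_def einterval_iff x_finite)

lemma cell_below: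
  assumes "k \<in> finite_nodes" "j < k" "t \<in> cell j"
  shows "t < node k"
proof -
  have "x (j + 1) \<le> x k"
    using x_less[of k "j + 1"] assms by (cases "j + 1 = k") (auto simp: finite_nodes_def)
  with assms show ?thesis
    by (auto simp: cell_def einterval_iff x_finite dest: less_le_trans)
qed

lemma disjoint_cell: "disjoint_family_on cell finite_nodes"
  unfolding disjoint_family_on_def
proof (intro ballI impI)
  have *: "cell j \<inter> cell k = {}" if "j \<in> finite_nodes" "k \<in> finite_nodes" "j < k" for j k
    using that cell_above[of k] cell_below[of k j] by fastforce
  fix j k assume "j \<in> finite_nodes" "k \<in> finite_nodes" "j \<noteq> k"
  then show "cell j \<inter> cell k = {}"
    using *[of j k] *[of k j] by (cases "j < k") auto
qed

text \<open>
  The mass below \<open>x\<^sub>k\<close> is \<open>2\<^sup>k\<close>, and the mass below \<open>x\<^sub>k\<^sub>+\<^sub>1\<close> is \<open>2\<^sup>k\<^sup>+\<^sup>1\<close>, or less if the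
  cell is the last one.
\<close>

lemma mass_cell_le:
  assumes "k \<in> Z"
  shows "(\<integral>\<^sup>+t\<in>cell k. u t \<partial>lebesgue) \<le> ennreal (2 powr k)"
proof -
  have "(\<integral>\<^sup>+t\<in>einterval 0 (x (k + 1)). u t \<partial>lebesgue) \<le> ennreal (2 powr (k + 1))"
  proof (cases "k + 1 \<in> Z")
    case True
    then show ?thesis by (simp add: mass_below)
  next
    case False
    then show ?thesis
      using last_index[OF assms False] by (simp add: einterval_zero less_imp_le)
  qed
  also have "ennreal (2 powr (k + 1)) = ennreal (2 powr k) + ennreal (2 powr k)"
    by (simp add: ennreal_plus[symmetric] powr_add del: ennreal_plus)
  also have "(\<integral>\<^sup>+t\<in>einterval 0 (x (k + 1)). u t \<partial>lebesgue) = ennreal (2 powr k) + (\<integral>\<^sup>+t\<in>cell k. u t \<partial>lebesgue)"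
  proof -
    have "x k \<le> x (k + 1)"
      using x_less[of "k + 1" k] last_index(1)[OF assms] by (cases "k + 1 \<in> Z") auto
    then show ?thesis
      using nn_integral_einterval_split[OF u_measurable, of "x k" "x (k + 1)"] x_pos[OF assms]
        mass_below[OF assms] by (simp add: cell_def less_imp_le)
  qed
  finally show ?thesis by (simp add: ennreal_add_left_cancel_le)
qed

text \<open>
  The cell to the left of a node is never the last one, so its mass is known exactly.
\<close>

lemma mass_cell_pred:
  assumes "k \<in> Z"
  shows "ennreal 2 * (\<integral>\<^sup>+t\<in>cell (k - 1). u t \<partial>lebesgue) = ennreal (2 powr k)"
proof -
  have k: "k - 1 \<in> Z" using finite_nodes_pred[OF assms] by (simp add: finite_nodes_def)
  have "ennreal (2 powr (k - 1)) + ennreal (2 powr (k - 1)) = ennreal (2 powr k)"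
    by (simp add: ennreal_plus[symmetric] powr_diff del: ennreal_plus)
  also have "\<dots> = ennreal (2 powr (k - 1)) + (\<integral>\<^sup>+t\<in>cell (k - 1). u t \<partial>lebesgue)"
    using nn_integral_einterval_split[OF u_measurable, of "x (k - 1)" "x k"] x_pos[OF k]
      mass_below[OF assms] mass_below[OF k] x_less[OF assms, of "k - 1"] by (simp add: cell_def less_imp_le)
  finally have "(\<integral>\<^sup>+t\<in>cell (k - 1). u t \<partial>lebesgue) = ennreal (2 powr (k - 1))"
    by (simp add: ennreal_add_left_cancel)
  then have "ennreal 2 * (\<integral>\<^sup>+t\<in>cell (k - 1). u t \<partial>lebesgue) = ennreal (2 * 2 powr (k - 1))"
    by (simp only: ennreal_mult zero_le_numeral powr_ge_zero)
  then show ?thesis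
    by (simp add: powr_diff)
qed

text \<open>
  The number \<open>m = \<integral>\<^sub>0\<^sup>t u\<close> is positive and finite. Nodes with \<open>2\<^sup>j < m\<close> lie at or to the left of \<open>t\<close>
  and nodes with \<open>2\<^sup>j > m\<close> lie to its right. Hence there is a last node at or to the left of \<open>t\<close>,
  and it opens the cell that is sought.
\<close>

lemma cover:
  assumes "0 < t"
  obtains k where "k \<in> finite_nodes" "x k \<le> ereal t" "ereal t < x (k + 1)"
proof -
  define m where "m = (\<integral>\<^sup>+s\<in>{0<..<t}. u s \<partial>lebesgue)"
  obtain m' where m': "m = ennreal m'" "0 < m'"
    using weight assms unfolding weights_def m_def by (cases m) (auto simp: m_def)
  have above: "2 powr j \<le> m'" if "j \<in> Z" "x j \<le> ereal t" for j
  proof -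
    have "ennreal (2 powr j) \<le> m"
      unfolding mass_below[OF that(1), symmetric] m_def using that(2)
      by (intro nn_integral_mono) (auto simp: einterval_iff split: split_indicator dest: less_le_trans)
    with m' show ?thesis by simp
  qed
  have below: "m' \<le> 2 powr j" if "j \<in> Z" "ereal t < x j" for j
  proof -
    have "m \<le> ennreal (2 powr j)"
      unfolding mass_below[OF that(1), symmetric] m_def using that(2)
      by (intro nn_integral_mono) (auto simp: einterval_iff split: split_indicator intro: less_trans[of "ereal _" "ereal t"])
    with m' show ?thesis by simp
  qed
  define n where "n = \<lceil>log 2 m'\<rceil>"
  have large: "m' < 2 powr j" if "n < j" for j :: int
  proof -
    have "log 2 m' < j" using that unfolding n_def by linarith
    then show ?thesis using m' by (simp add: log_less_iff)
  qed
  define S where "S = {j \<in> Z. x j \<le> ereal t}"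
  have bound: "j \<le> n" if "j \<in> S" for j
    using above[of j] large[of j] that by (force simp: S_def)
  obtain z where z: "z \<in> Z"
    using covering by (auto simp: covering_sequence_def split: if_splits)
  obtain j where j: "j \<le> z" "2 powr j < m'"
  proof
    define j where "j = min z (\<lfloor>log 2 m'\<rfloor> - 1)"
    show "j \<le> z" by (simp add: j_def)
    have "real_of_int j < log 2 m'" unfolding j_def by linarith
    then show "2 powr j < m'" using m' by (simp add: less_log_iff)
  qed
  then have "j \<in> S"
    using below[of j] Z_downward[OF z j(1)] unfolding S_def by force
  define k where "k = Max (S \<inter> {j..n})"
  have fin: "finite (S \<inter> {j..n})" by simp
  have "k \<in> S \<inter> {j..n}"
    unfolding k_def using \<open>j \<in> S\<close> bound[of j] by (intro Max_in) auto
  moreover have "k + 1 \<notin> S"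
  proof
    assume "k + 1 \<in> S"
    with \<open>k \<in> S \<inter> {j..n}\<close> bound[of "k + 1"] have "k + 1 \<in> S \<inter> {j..n}" by auto
    from Max_ge[OF fin this] show False by (simp add: k_def)
  qed
  ultimately show thesis
    using last_index(1)[of k] by (intro that[of k]) (auto simp: S_def finite_nodes_def not_le dest: le_less_trans)
qed

text \<open>
  The cells are disjoint and miss only the countably many nodes, so countable additivity of the
  measure with density \<open>f\<close> applies.
\<close>

lemma nn_integral_partition:
  assumes f: "f \<in> nonneg_measurable"
  shows "(\<integral>\<^sup>+t\<in>{0<..}. f t \<partial>lebesgue) = (\<integral>\<^sup>+k\<in>finite_nodes. (\<integral>\<^sup>+t\<in>cell k. f t \<partial>lebesgue) \<partial>count_space UNIV)"
proof -
  define M where "M = density lebesgue (\<lambda>t. f t * indicator {0<..} t)"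
  have M: "emeasure M A = (\<integral>\<^sup>+t\<in>A. f t \<partial>lebesgue)" if "A \<in> sets lebesgue" "A \<subseteq> {0<..}" for A
  proof -
    have "emeasure M A = (\<integral>\<^sup>+t. f t * indicator {0<..} t * indicator A t \<partial>lebesgue)"
      unfolding M_def using that by (intro emeasure_density nonneg_measurable_indicator f) auto
    also have "\<dots> = (\<integral>\<^sup>+t\<in>A. f t \<partial>lebesgue)"
      using that by (intro nn_integral_cong) (auto split: split_indicator)
    finally show ?thesis .
  qed
  have cell: "cell k \<in> sets lebesgue" "cell k \<in> sets M" for k
    by (simp_all add: cell_def M_def)
  have pos: "cell k \<subseteq> {0<..}" if "k \<in> finite_nodes" for k
    using cell_pos that by (simp add: finite_nodes_def)
  have "(\<integral>\<^sup>+t\<in>{0<..}. f t \<partial>lebesgue) = (\<integral>\<^sup>+t\<in>(\<Union>k\<in>finite_nodes. cell k). f t \<partial>lebesgue)"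
  proof (rule nn_integral_cong_AE)
    have "AE t in lebesgue. t \<notin> node ` finite_nodes"
      by (rule AE_lebesgue_countable) simp
    then show "AE t in lebesgue. f t * indicator {0<..} t = f t * indicator (\<Union>k\<in>finite_nodes. cell k) t"
    proof eventually_elim
      case (elim t)
      have "t \<in> (\<Union>k\<in>finite_nodes. cell k)" if "0 < t"
      proof -
        obtain k where k: "k \<in> finite_nodes" "x k \<le> ereal t" "ereal t < x (k + 1)"
          using cover \<open>0 < t\<close> by blast
        moreover have "node k \<noteq> t" using elim k by auto
        ultimately show ?thesis
          by (auto simp: cell_def einterval_iff x_finite intro!: bexI[of _ k])
      qed
      then show ?case using pos by (auto split: split_indicator)
    qed
  qed
  also have "\<dots> = emeasure M (\<Union>k\<in>finite_nodes. cell k)"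
    using cell pos by (intro M[symmetric]) (auto intro!: sets.countable_UN')
  also have "\<dots> = (\<integral>\<^sup>+k. emeasure M (cell k) \<partial>count_space finite_nodes)"
    using disjoint_cell cell by (intro emeasure_UN_countable) auto
  also have "\<dots> = (\<integral>\<^sup>+k. (\<integral>\<^sup>+t\<in>cell k. f t \<partial>lebesgue) \<partial>count_space finite_nodes)"
    using cell pos by (intro nn_integral_cong M) auto
  finally show ?thesis
    by (simp add: nn_integral_count_space_indicator)
qed

lemma nn_integral_tail:
  assumes f: "f \<in> nonneg_measurable" and k: "k \<in> finite_nodes"
  shows "(\<integral>\<^sup>+t\<in>{node k<..}. f t \<partial>lebesgue)
    \<le> (\<Sum>i. (\<integral>\<^sup>+t\<in>cell (k + int i). f t \<partial>lebesgue) * indicator finite_nodes (k + int i))"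
proof -
  define g where "g t = f t * indicator {node k<..} t" for t
  have g: "g \<in> nonneg_measurable"
    unfolding g_def[abs_def] using f
    by (rule nonneg_measurable_mult) (auto intro!: nonneg_measurable_monotone monoI split: split_indicator)
  have "(\<integral>\<^sup>+t\<in>{node k<..}. f t \<partial>lebesgue) = (\<integral>\<^sup>+t\<in>{0<..}. g t \<partial>lebesgue)"
    using x_finite(2)[OF k] by (intro nn_integral_cong) (auto simp: g_def split: split_indicator)
  also have "\<dots> = (\<integral>\<^sup>+j\<in>finite_nodes. (\<integral>\<^sup>+t\<in>cell j. g t \<partial>lebesgue) \<partial>count_space UNIV)"
    by (rule nn_integral_partition[OF g])
  also have "\<dots> \<le> (\<integral>\<^sup>+j\<in>{k..}. (\<integral>\<^sup>+t\<in>cell j. f t \<partial>lebesgue) * indicator finite_nodes j \<partial>count_space UNIV)"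
  proof (rule nn_integral_mono)
    fix j
    have "(\<integral>\<^sup>+t\<in>cell j. g t \<partial>lebesgue) = 0" if "j < k"
    proof -
      have "g t * indicator (cell j) t = 0" for t
        using cell_below[OF k that, of t] by (auto simp: g_def split: split_indicator)
      then show ?thesis by (simp only: nn_integral_const mult_zero_left)
    qed
    moreover have "(\<integral>\<^sup>+t\<in>cell j. g t \<partial>lebesgue) \<le> (\<integral>\<^sup>+t\<in>cell j. f t \<partial>lebesgue)"
      by (intro nn_integral_mono) (auto simp: g_def split: split_indicator)
    ultimately show "(\<integral>\<^sup>+t\<in>cell j. g t \<partial>lebesgue) * indicator finite_nodes j
      \<le> (\<integral>\<^sup>+t\<in>cell j. f t \<partial>lebesgue) * indicator finite_nodes j * indicator {k..} j"
      by (cases "j < k") (auto split: split_indicator)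
  qed
  finally show ?thesis by (simp add: nn_integral_int_atLeast)
qed

text \<open>
  On the cell to the right of \<open>x\<^sub>k\<close>, which has mass at most \<open>2\<^sup>k\<close>, the function \<open>\<phi>\<close> is at most
  \<open>\<phi>(x\<^sub>k)\<close>.
\<close>

lemma discretize_upper:
  assumes \<phi>: "antimono \<phi>"
  shows "(\<integral>\<^sup>+t\<in>{0<..}. \<phi> t * u t \<partial>lebesgue)
    \<le> (\<integral>\<^sup>+k\<in>finite_nodes. ennreal (2 powr k) * \<phi> (node k) \<partial>count_space UNIV)"
proof -
  have "(\<integral>\<^sup>+t\<in>{0<..}. \<phi> t * u t \<partial>lebesgue)
    = (\<integral>\<^sup>+k\<in>finite_nodes. (\<integral>\<^sup>+t\<in>cell k. \<phi> t * u t \<partial>lebesgue) \<partial>count_space UNIV)"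
    using \<phi> by (intro nn_integral_partition nonneg_measurable_mult u_measurable nonneg_measurable_monotone) simp
  also have "\<dots> \<le> (\<integral>\<^sup>+k\<in>finite_nodes. ennreal (2 powr k) * \<phi> (node k) \<partial>count_space UNIV)"
  proof (rule nn_integral_mono)
    fix k
    have "(\<integral>\<^sup>+t\<in>cell k. \<phi> t * u t \<partial>lebesgue) \<le> ennreal (2 powr k) * \<phi> (node k)" if k: "k \<in> finite_nodes"
    proof -
      have "(\<integral>\<^sup>+t\<in>cell k. \<phi> t * u t \<partial>lebesgue) \<le> (\<integral>\<^sup>+t. \<phi> (node k) * (u t * indicator (cell k) t) \<partial>lebesgue)"
        using cell_above[OF k] antimonoD[OF \<phi>]
        by (intro nn_integral_mono) (auto split: split_indicator intro!: mult_right_mono dest: less_imp_le)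
      also have "\<dots> = \<phi> (node k) * (\<integral>\<^sup>+t\<in>cell k. u t \<partial>lebesgue)"
        using cell_pos[OF finite_nodes_subset[OF k]]
        by (intro nn_integral_cmult nonneg_measurable_indicator u_measurable) (auto simp: cell_def)
      also have "\<dots> \<le> \<phi> (node k) * ennreal (2 powr k)"
        by (intro mult_left_mono mass_cell_le finite_nodes_subset k) simp
      finally show ?thesis by (simp add: mult.commute)
    qed
    then show "(\<integral>\<^sup>+t\<in>cell k. \<phi> t * u t \<partial>lebesgue) * indicator finite_nodes k \<le> ennreal (2 powr k) * \<phi> (node k) * indicator finite_nodes k"
      by (auto split: split_indicator)
  qed
  finally show ?thesis .
qed

text \<open>
  On the cell to the left of \<open>x\<^sub>k\<close>, which has mass \<open>2\<^sup>k / 2\<close>, the function \<open>\<phi>\<close> is at least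
  \<open>\<phi>(x\<^sub>k)\<close>. Comparing with the left neighbour shifts the index by one.
\<close>

lemma discretize_lower:
  assumes \<phi>: "antimono \<phi>"
  shows "(\<integral>\<^sup>+k\<in>finite_nodes. ennreal (2 powr k) * \<phi> (node k) \<partial>count_space UNIV)
    \<le> ennreal 2 * (\<integral>\<^sup>+t\<in>{0<..}. \<phi> t * u t \<partial>lebesgue)"
proof -
  define I where "I k = (\<integral>\<^sup>+t\<in>cell k. \<phi> t * u t \<partial>lebesgue) * indicator finite_nodes k" for k
  have "(\<integral>\<^sup>+k\<in>finite_nodes. ennreal (2 powr k) * \<phi> (node k) \<partial>count_space UNIV)
    \<le> (\<integral>\<^sup>+k. ennreal 2 * I (k + - 1) \<partial>count_space UNIV)"
  proof (rule nn_integral_mono)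
    fix k
    have "ennreal (2 powr k) * \<phi> (node k) \<le> ennreal 2 * I (k + - 1)" if k: "k \<in> finite_nodes"
    proof -
      have k1: "k - 1 \<in> finite_nodes" using finite_nodes_pred finite_nodes_subset k by blast
      have "\<phi> (node k) * (\<integral>\<^sup>+t\<in>cell (k - 1). u t \<partial>lebesgue) = (\<integral>\<^sup>+t. \<phi> (node k) * (u t * indicator (cell (k - 1)) t) \<partial>lebesgue)"
        using cell_pos[OF finite_nodes_subset[OF k1]]
        by (intro nn_integral_cmult[symmetric] nonneg_measurable_indicator u_measurable) (auto simp: cell_def)
      also have "\<dots> \<le> (\<integral>\<^sup>+t\<in>cell (k - 1). \<phi> t * u t \<partial>lebesgue)"
        using cell_below[OF k, of "k - 1"] antimonoD[OF \<phi>]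
        by (intro nn_integral_mono) (auto split: split_indicator intro!: mult_right_mono dest: less_imp_le)
      finally have "\<phi> (node k) * (\<integral>\<^sup>+t\<in>cell (k - 1). u t \<partial>lebesgue) \<le> I (k + - 1)"
        using k1 by (simp add: I_def)
      then have "ennreal 2 * (\<phi> (node k) * (\<integral>\<^sup>+t\<in>cell (k - 1). u t \<partial>lebesgue)) \<le> ennreal 2 * I (k + - 1)"
        by (rule mult_left_mono) simp
      then show ?thesis
        unfolding mass_cell_pred[OF finite_nodes_subset[OF k], symmetric] by (simp only: mult_ac)
    qed
    then show "ennreal (2 powr k) * \<phi> (node k) * indicator finite_nodes k \<le> ennreal 2 * I (k + - 1)"
      by (auto split: split_indicator)
  qed
  also have "\<dots> = ennreal 2 * (\<integral>\<^sup>+k. I (k + - 1) \<partial>count_space UNIV)"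
    by (rule nn_integral_cmult) simp
  also have "(\<integral>\<^sup>+k. I (k + - 1) \<partial>count_space UNIV) = (\<integral>\<^sup>+k. I k \<partial>count_space UNIV)"
    by (rule nn_integral_int_shift)
  also have "\<dots> = (\<integral>\<^sup>+t\<in>{0<..}. \<phi> t * u t \<partial>lebesgue)"
    unfolding I_def using \<phi>
    by (intro nn_integral_partition[symmetric] nonneg_measurable_mult u_measurable nonneg_measurable_monotone) simp
  finally show ?thesis .
qed

end

section \<open>The two sides of the equivalence at the level of cells\<close>

locale covering_data = covering +
  fixes q r :: real and w h :: "real \<Rightarrow> ennreal"
  assumes q: "0 < q" and r: "0 < r"
    and w: "w \<in> nonneg_measurable" and h: "h \<in> nonneg_measurable"
begin

text \<open>
  The functions \<open>F\<close> and \<open>A\<close> omit the outer exponent \<open>1/q\<close>, because the integral without it is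
  additive over the cells.
\<close>

definition H :: "real \<Rightarrow> ennreal" where "H t = (\<integral>\<^sup>+z\<in>{0<..<t}. h z \<partial>lebesgue)"

definition W :: "real \<Rightarrow> ennreal" where "W s = (\<integral>\<^sup>+t\<in>{s<..}. w t \<partial>lebesgue)"

definition F :: "real \<Rightarrow> ennreal" where "F y = (\<integral>\<^sup>+t\<in>{y<..}. H t epowr q * w t \<partial>lebesgue)"

definition G :: "real \<Rightarrow> ennreal" where "G y = (SUP s\<in>{y..}. W s epowr (1 / q) * H s)"

definition A :: "int \<Rightarrow> ennreal" where
  "A k = (\<integral>\<^sup>+t\<in>cell k. (\<integral>\<^sup>+z\<in>einterval (x k) (ereal t). h z \<partial>lebesgue) epowr q * w t \<partial>lebesgue)"

definition local_sum :: ennreal where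
  "local_sum = (\<integral>\<^sup>+k\<in>finite_nodes. ennreal (2 powr k) * A k epowr (r / q) \<partial>count_space UNIV)"

lemma mono_H: "mono H"
  unfolding H_def by (intro monoI nn_integral_mono) (auto split: split_indicator)

lemma antimono_F: "antimono (\<lambda>y. F y epowr (r / q))"
  unfolding F_def using q r
  by (intro antimonoI epowr_mono nn_integral_mono) (auto split: split_indicator)

lemma antimono_G: "antimono (\<lambda>y. G y epowr r)"
  unfolding G_def using r by (intro antimonoI epowr_mono SUP_subset_mono) auto

text \<open>
  For \<open>s \<ge> y\<close> one has \<open>H(s)\<^sup>q W(s) \<le> F(s) \<le> F(y)\<close>, since \<open>H \<ge> H(s)\<close> to the right of \<open>s\<close>.
\<close>

lemma G_le_F:
  assumes "0 < y"
  shows "G y epowr r \<le> F y epowr (r / q)"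
proof -
  have "W s epowr (1 / q) * H s \<le> F y epowr (1 / q)" if "y \<le> s" for s
  proof -
    have "H s epowr q * W s = (\<integral>\<^sup>+t. H s epowr q * (w t * indicator {s<..} t) \<partial>lebesgue)"
      unfolding W_def using that assms
      by (intro nn_integral_cmult[symmetric] nonneg_measurable_indicator w) auto
    also have "\<dots> \<le> F y"
      unfolding F_def using that monoD[OF mono_H] q
      by (intro nn_integral_mono) (auto split: split_indicator intro!: mult_right_mono epowr_mono)
    finally have "(H s epowr q * W s) epowr (1 / q) \<le> F y epowr (1 / q)"
      using q by (intro epowr_mono) auto
    then show ?thesis
      using q by (simp add: epowr_mult epowr_inverse mult.commute)
  qed
  then have "G y \<le> F y epowr (1 / q)"
    unfolding G_def by (intro SUP_least) auto
  then have "G y epowr r \<le> (F y epowr (1 / q)) epowr r"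
    using r by (intro epowr_mono) auto
  then show ?thesis using q by (simp add: epowr_epowr)
qed

lemma A_le_F:
  assumes k: "k \<in> finite_nodes"
  shows "A k \<le> F (node k)"
  unfolding A_def F_def
proof (rule nn_integral_mono)
  fix t
  have "(\<integral>\<^sup>+z\<in>einterval (x k) (ereal t). h z \<partial>lebesgue) \<le> H t"
    unfolding H_def using x_pos[OF finite_nodes_subset[OF k]]
    by (intro nn_integral_mono) (auto simp: einterval_iff split: split_indicator dest: less_trans)
  then show "(\<integral>\<^sup>+z\<in>einterval (x k) (ereal t). h z \<partial>lebesgue) epowr q * w t * indicator (cell k) t
    \<le> H t epowr q * w t * indicator {node k<..} t"
    using q cell_above[OF k, of t] by (auto split: split_indicator intro!: mult_right_mono epowr_mono)
qed

text \<open>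
  The primitive of \<open>h\<close> is its value at the left node plus the local primitive \<open>L\<close>. The constant
  part multiplies the integral of \<open>w\<close> over the cell, which is at most \<open>W(x\<^sub>k)\<close>, so the supremum
  defining \<open>G\<close> at the node, tested with \<open>s = x\<^sub>k\<close>, absorbs it.
\<close>

lemma F_local_le:
  assumes k: "k \<in> finite_nodes"
  shows "(\<integral>\<^sup>+t\<in>cell k. H t epowr q * w t \<partial>lebesgue) \<le> ennreal (2 powr q) * (G (node k) epowr q + A k)"
proof -
  define L where "L t = (\<integral>\<^sup>+z\<in>einterval (x k) (ereal t). h z \<partial>lebesgue)" for t
  have L: "mono L"
    unfolding L_def by (intro monoI nn_integral_mono)
      (auto simp: einterval_iff split: split_indicator dest: less_le_trans[of "ereal _" "ereal _" "ereal _"])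
  have cell_k: "cell k \<in> sets lebesgue" "cell k \<subseteq> {0<..}"
    using cell_pos[OF finite_nodes_subset[OF k]] by (auto simp: cell_def)
  have "(\<integral>\<^sup>+t\<in>cell k. H t epowr q * w t \<partial>lebesgue)
    \<le> (\<integral>\<^sup>+t. ennreal (2 powr q) * (H (node k) epowr q * (w t * indicator (cell k) t) + L t epowr q * w t * indicator (cell k) t) \<partial>lebesgue)"
  proof (rule nn_integral_mono)
    fix t
    have "H t epowr q * w t \<le> ennreal (2 powr q) * (H (node k) epowr q + L t epowr q) * w t" if "t \<in> cell k"
    proof (rule mult_right_mono)
      have "H t = H (node k) + L t"
        using nn_integral_einterval_split[OF h, of "x k" "ereal t"] x_finite[OF k] cell_above[OF k that]
        by (simp add: H_def L_def einterval_zero)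
      then show "H t epowr q \<le> ennreal (2 powr q) * (H (node k) epowr q + L t epowr q)"
        using epowr_add_le[of q "H (node k)" "L t"] q by simp
    qed simp
    then show "H t epowr q * w t * indicator (cell k) t
      \<le> ennreal (2 powr q) * (H (node k) epowr q * (w t * indicator (cell k) t) + L t epowr q * w t * indicator (cell k) t)"
      by (auto simp: algebra_simps split: split_indicator)
  qed
  also have "\<dots> = ennreal (2 powr q) * (H (node k) epowr q * (\<integral>\<^sup>+t\<in>cell k. w t \<partial>lebesgue) + A k)"
  proof -
    have m1: "(\<lambda>t. w t * indicator (cell k) t) \<in> borel_measurable lebesgue"
      using cell_k w by (intro nonneg_measurable_indicator)
    have m2: "(\<lambda>t. L t epowr q * w t * indicator (cell k) t) \<in> borel_measurable lebesgue"
      using L by (intro nonneg_measurable_indicator nonneg_measurable_mult nonneg_measurable_epowr w cell_k,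
        intro nonneg_measurable_monotone) simp
    have "(\<integral>\<^sup>+t. a * (b * f t + g t) \<partial>lebesgue) = a * (b * (\<integral>\<^sup>+t. f t \<partial>lebesgue) + (\<integral>\<^sup>+t. g t \<partial>lebesgue))"
      if [measurable]: "f \<in> borel_measurable lebesgue" "g \<in> borel_measurable lebesgue" for a b f g
      by (simp add: nn_integral_cmult nn_integral_add)
    from this[OF m1 m2] show ?thesis
      by (simp add: A_def L_def)
  qed
  also have "\<dots> \<le> ennreal (2 powr q) * (G (node k) epowr q + A k)"
  proof (intro mult_left_mono add_right_mono)
    have "(\<integral>\<^sup>+t\<in>cell k. w t \<partial>lebesgue) \<le> W (node k)"
      unfolding W_def using cell_above[OF k] by (intro nn_integral_mono) (auto split: split_indicator)
    then have "H (node k) epowr q * (\<integral>\<^sup>+t\<in>cell k. w t \<partial>lebesgue) \<le> H (node k) epowr q * W (node k)"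
      by (rule mult_left_mono) simp
    also have "\<dots> = (W (node k) epowr (1 / q) * H (node k)) epowr q"
      using q by (simp add: epowr_mult epowr_inverse mult.commute)
    also have "\<dots> \<le> G (node k) epowr q"
      unfolding G_def using q by (intro epowr_mono SUP_upper) auto
    finally show "H (node k) epowr q * (\<integral>\<^sup>+t\<in>cell k. w t \<partial>lebesgue) \<le> G (node k) epowr q" .
  qed simp
  finally show ?thesis .
qed

lemma lower_bound:
  "local_sum \<le> ennreal 2 * (\<integral>\<^sup>+y\<in>{0<..}. F y epowr (r / q) * u y \<partial>lebesgue)"
  "(\<integral>\<^sup>+y\<in>{0<..}. G y epowr r * u y \<partial>lebesgue) \<le> (\<integral>\<^sup>+y\<in>{0<..}. F y epowr (r / q) * u y \<partial>lebesgue)"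
proof -
  have "local_sum \<le> (\<integral>\<^sup>+k\<in>finite_nodes. ennreal (2 powr k) * F (node k) epowr (r / q) \<partial>count_space UNIV)"
    unfolding local_sum_def using A_le_F q r
    by (intro nn_integral_mono) (auto split: split_indicator intro!: mult_left_mono epowr_mono)
  also have "\<dots> \<le> ennreal 2 * (\<integral>\<^sup>+y\<in>{0<..}. F y epowr (r / q) * u y \<partial>lebesgue)"
    by (rule discretize_lower[OF antimono_F])
  finally show "local_sum \<le> ennreal 2 * (\<integral>\<^sup>+y\<in>{0<..}. F y epowr (r / q) * u y \<partial>lebesgue)" .
  show "(\<integral>\<^sup>+y\<in>{0<..}. G y epowr r * u y \<partial>lebesgue) \<le> (\<integral>\<^sup>+y\<in>{0<..}. F y epowr (r / q) * u y \<partial>lebesgue)"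
    using G_le_F by (intro nn_integral_mono) (auto split: split_indicator intro!: mult_right_mono)
qed

text \<open>
  Restricting the sum to the finite nodes changes nothing, since the cell of an infinite node is
  empty.
\<close>

lemma lr_norm_local:
  "lr_norm r Z (\<lambda>k. ennreal (2 powr (k / r)) *
      (\<integral>\<^sup>+t\<in>einterval (x k) (x (k + 1)).
         (\<integral>\<^sup>+z\<in>einterval (x k) (ereal t). h z \<partial>lebesgue) epowr q * w t \<partial>lebesgue) epowr (1 / q))
    = local_sum epowr (1 / r)"
proof -
  have "(\<integral>\<^sup>+k\<in>Z. (ennreal (2 powr (k / r)) * A k epowr (1 / q)) epowr r \<partial>count_space UNIV) = local_sum"
    unfolding local_sum_def
  proof (rule nn_integral_cong)
    fix k
    have "(ennreal (2 powr (k / r)) * A k epowr (1 / q)) epowr r = ennreal (2 powr k) * A k epowr (r / q)"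
      using q r by (simp add: epowr_mult epowr_ennreal powr_powr epowr_epowr)
    moreover have "A k = 0" if "k \<in> Z" "k \<notin> finite_nodes"
      using cell_empty[OF that] by (simp add: A_def)
    ultimately show "(ennreal (2 powr (k / r)) * A k epowr (1 / q)) epowr r * indicator Z k
      = ennreal (2 powr k) * A k epowr (r / q) * indicator finite_nodes k"
      using finite_nodes_subset[of k] by (auto split: split_indicator)
  qed
  then show ?thesis
    unfolding lr_norm_def infsum_ennreal_int_eq_nn_integral A_def cell_def by simp
qed

text \<open>
  The Hardy inequality is applied with the exponent \<open>r/q\<close> to the integrals \<open>b\<^sub>k\<close> of \<open>H\<^sup>q w\<close> over the
  cells, whose tail sums dominate \<open>F\<close> at the nodes. The constant \<open>K\<close> is a parameter because it
  has to be chosen before the weights are.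
\<close>

lemma upper_bound:
  assumes K: "\<And>b :: int \<Rightarrow> ennreal.
      (\<integral>\<^sup>+k. ennreal (2 powr k) * (\<Sum>i. b (k + int i)) epowr (r / q) \<partial>count_space UNIV)
      \<le> ennreal K * (\<integral>\<^sup>+k. ennreal (2 powr k) * b k epowr (r / q) \<partial>count_space UNIV)"
    and "0 < K"
  shows "(\<integral>\<^sup>+y\<in>{0<..}. F y epowr (r / q) * u y \<partial>lebesgue)
    \<le> ennreal (K * 2 powr r * 2 powr (r / q) * 2)
      * (local_sum + (\<integral>\<^sup>+y\<in>{0<..}. G y epowr r * u y \<partial>lebesgue))"
proof -
  define b where "b k = (\<integral>\<^sup>+t\<in>cell k. H t epowr q * w t \<partial>lebesgue) * indicator finite_nodes k" for k
  define C where "C = 2 powr r * 2 powr (r / q)"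
  have Hw: "(\<lambda>t. H t epowr q * w t) \<in> nonneg_measurable"
    using mono_H by (intro nonneg_measurable_mult nonneg_measurable_epowr w, intro nonneg_measurable_monotone) simp
  have b_le: "b k epowr (r / q) \<le> ennreal C * ((G (node k) epowr r + A k epowr (r / q)) * indicator finite_nodes k)" for k
  proof (cases "k \<in> finite_nodes")
    case True
    have "b k epowr (r / q) \<le> (ennreal (2 powr q) * (G (node k) epowr q + A k)) epowr (r / q)"
      using F_local_le[OF True] q r True by (intro epowr_mono) (auto simp: b_def)
    also have "\<dots> = ennreal (2 powr r) * (G (node k) epowr q + A k) epowr (r / q)"
      using q by (simp add: epowr_mult epowr_ennreal powr_powr)
    also have "\<dots> \<le> ennreal (2 powr r) * (ennreal (2 powr (r / q)) * ((G (node k) epowr q) epowr (r / q) + A k epowr (r / q)))"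
      using q r by (intro mult_left_mono epowr_add_le) auto
    also have "\<dots> = ennreal C * (G (node k) epowr r + A k epowr (r / q))"
      using q by (simp add: C_def ennreal_mult mult.assoc epowr_epowr)
    finally show ?thesis using True by simp
  qed (simp add: b_def)
  have "(\<integral>\<^sup>+y\<in>{0<..}. F y epowr (r / q) * u y \<partial>lebesgue)
    \<le> (\<integral>\<^sup>+k\<in>finite_nodes. ennreal (2 powr k) * F (node k) epowr (r / q) \<partial>count_space UNIV)"
    by (rule discretize_upper[OF antimono_F])
  also have "\<dots> \<le> (\<integral>\<^sup>+k. ennreal (2 powr k) * (\<Sum>i. b (k + int i)) epowr (r / q) \<partial>count_space UNIV)"
  proof (rule nn_integral_mono)
    fix k
    have "F (node k) \<le> (\<Sum>i. b (k + int i))" if "k \<in> finite_nodes"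
      unfolding F_def b_def by (rule nn_integral_tail[OF Hw that])
    then show "ennreal (2 powr k) * F (node k) epowr (r / q) * indicator finite_nodes k
      \<le> ennreal (2 powr k) * (\<Sum>i. b (k + int i)) epowr (r / q)"
      using q r by (auto split: split_indicator intro!: mult_left_mono epowr_mono)
  qed
  also have "\<dots> \<le> ennreal K * (\<integral>\<^sup>+k. ennreal (2 powr k) * b k epowr (r / q) \<partial>count_space UNIV)"
    by (rule K)
  also have "\<dots> \<le> ennreal K * (\<integral>\<^sup>+k. ennreal C * (ennreal (2 powr k) * (G (node k) epowr r + A k epowr (r / q)) * indicator finite_nodes k) \<partial>count_space UNIV)"
  proof (intro mult_left_mono nn_integral_mono)
    fix k :: int
    have "ennreal (2 powr k) * b k epowr (r / q)
      \<le> ennreal (2 powr k) * (ennreal C * ((G (node k) epowr r + A k epowr (r / q)) * indicator finite_nodes k))"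
      by (intro mult_left_mono b_le) simp
    then show "ennreal (2 powr k) * b k epowr (r / q)
      \<le> ennreal C * (ennreal (2 powr k) * (G (node k) epowr r + A k epowr (r / q)) * indicator finite_nodes k)"
      by (simp only: mult_ac)
  qed simp
  also have "(\<integral>\<^sup>+k. ennreal C * (ennreal (2 powr k) * (G (node k) epowr r + A k epowr (r / q)) * indicator finite_nodes k) \<partial>count_space UNIV)
    = ennreal C * ((\<integral>\<^sup>+k\<in>finite_nodes. ennreal (2 powr k) * G (node k) epowr r \<partial>count_space UNIV) + local_sum)"
    unfolding local_sum_def
    by (subst nn_integral_cmult, simp, subst nn_integral_add[symmetric]) (simp_all add: distrib_left distrib_right)
  also have "\<dots> \<le> ennreal C * (ennreal 2 * (\<integral>\<^sup>+y\<in>{0<..}. G y epowr r * u y \<partial>lebesgue) + ennreal 2 * local_sum)"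
  proof (intro mult_left_mono add_mono)
    show "local_sum \<le> ennreal 2 * local_sum" by (simp add: mult_2)
  qed (use discretize_lower[OF antimono_G] in simp_all)
  also have "\<dots> = ennreal (C * 2) * (local_sum + (\<integral>\<^sup>+y\<in>{0<..}. G y epowr r * u y \<partial>lebesgue))"
    by (simp add: C_def ennreal_mult distrib_left mult.assoc add.commute)
  finally show ?thesis
    using \<open>0 < K\<close> by (simp add: C_def ennreal_mult mult.assoc mult_left_mono)
qed

end

section \<open>The equivalence\<close>

lemma equivalent_withI:
  assumes "L \<le> ennreal a * R" "R \<le> ennreal b * L" "0 < a" "0 < b"
  shows "equivalent_with (a + b) L R"
  unfolding equivalent_with_def
proof
  have "L \<le> ennreal (a + b) * R"
    using assms by (elim order_trans) (auto intro!: mult_right_mono ennreal_leI)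
  then have "ennreal (1 / (a + b)) * L \<le> ennreal (1 / (a + b)) * (ennreal (a + b) * R)"
    by (rule mult_left_mono) simp
  also have "\<dots> = ennreal (1 / (a + b) * (a + b)) * R"
    using assms by (simp only: ennreal_mult mult.assoc divide_nonneg_nonneg add_nonneg_nonneg less_imp_le zero_le_one)
  also have "\<dots> = R"
    using assms by simp
  finally show "ennreal (1 / (a + b)) * L \<le> R" .
  show "R \<le> ennreal (a + b) * L"
    using assms by (elim order_trans) (auto intro!: mult_right_mono ennreal_leI)
qed

text \<open>
  Taking \<open>r\<close>-th roots of a two-sided estimate. Each summand \<open>N\<close>, \<open>Y\<close> is at most the \<open>r\<close>-th power
  of the sum of the roots, which accounts for the factor \<open>2\<close> next to \<open>K\<close>.
\<close>

lemma equivalent_with_of_powers: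
  assumes "0 < r" "0 < K"
    and upper: "X \<le> ennreal K * (N + Y)"
    and lower: "N \<le> ennreal 2 * X" "Y \<le> X"
  shows "equivalent_with ((K * 2) powr (1 / r) + (2 powr (1 / r) + 1))
    (X epowr (1 / r)) (N epowr (1 / r) + Y epowr (1 / r))"
proof (rule equivalent_withI)
  define R where "R = N epowr (1 / r) + Y epowr (1 / r)"
  have "a \<le> R epowr r" if "a epowr (1 / r) \<le> R" for a
    using epowr_mono[OF that, of r] assms(1) by (simp add: epowr_inverse)
  then have "N + Y \<le> R epowr r + R epowr r"
    by (intro add_mono) (auto simp: R_def)
  then have "ennreal K * (N + Y) \<le> ennreal K * (ennreal 2 * R epowr r)"
    by (intro mult_left_mono) (auto simp: mult_2)
  with upper have "X \<le> ennreal K * (ennreal 2 * R epowr r)"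
    by (rule order_trans)
  also have "\<dots> = ennreal (K * 2) * R epowr r"
    using assms(2) by (simp add: ennreal_mult mult.assoc)
  finally have "X epowr (1 / r) \<le> (ennreal (K * 2) * R epowr r) epowr (1 / r)"
    using assms(1) by (intro epowr_mono) auto
  then show "X epowr (1 / r) \<le> ennreal ((K * 2) powr (1 / r)) * (N epowr (1 / r) + Y epowr (1 / r))"
    unfolding R_def[symmetric] using assms(1,2) by (subst (asm) epowr_mult) (simp add: epowr_inverse epowr_ennreal)
  have "N epowr (1 / r) \<le> ennreal (2 powr (1 / r)) * X epowr (1 / r)"
    using epowr_mono[OF lower(1), of "1 / r"] assms(1) epowr_ennreal[of 2 "1 / r"] by (simp add: epowr_mult)
  moreover have "Y epowr (1 / r) \<le> X epowr (1 / r)"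
    using assms(1) lower(2) by (intro epowr_mono) auto
  ultimately have "N epowr (1 / r) + Y epowr (1 / r) \<le> ennreal (2 powr (1 / r)) * X epowr (1 / r) + X epowr (1 / r)"
    by (rule add_mono)
  then show "N epowr (1 / r) + Y epowr (1 / r) \<le> ennreal (2 powr (1 / r) + 1) * X epowr (1 / r)"
    by (simp add: distrib_right)
  show "0 < (K * 2) powr (1 / r)" "0 < 2 powr (1 / r) + (1::real)"
    using assms(2) by (auto intro!: add_pos_pos)
qed

theorem theorem3p3:
  fixes q r :: real
  assumes "0 < q" and "0 < r"
  shows "\<exists>c>0. \<forall>u\<in>weights. \<forall>v\<in>weights. \<forall>w\<in>weights. \<forall>Z x. covering_sequence u Z x \<longrightarrow>
    (\<forall>h\<in>nonneg_measurable.
      equivalent_with c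
        ((\<integral>\<^sup>+y\<in>{0<..}. (\<integral>\<^sup>+t\<in>{y<..}. (\<integral>\<^sup>+z\<in>{0<..<t}. h z \<partial>lebesgue) epowr q * w t \<partial>lebesgue) epowr (r / q)
            * u y \<partial>lebesgue) epowr (1 / r))
        (lr_norm r Z (\<lambda>k. ennreal (2 powr (k / r)) *
            (\<integral>\<^sup>+t\<in>einterval (x k) (x (k + 1)).
               (\<integral>\<^sup>+z\<in>einterval (x k) (ereal t). h z \<partial>lebesgue) epowr q * w t \<partial>lebesgue) epowr (1 / q))
         + (\<integral>\<^sup>+y\<in>{0<..}. u y *
             (SUP s\<in>{y..}. (\<integral>\<^sup>+t\<in>{s<..}. w t \<partial>lebesgue) epowr (1 / q) *
                          (\<integral>\<^sup>+z\<in>{0<..<s}. h z \<partial>lebesgue)) epowr r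
            \<partial>lebesgue) epowr (1 / r)))"
  proof -
  have "0 < r / q" using assms by simp
  from geometric_hardy_inequality[OF this] obtain K where K: "0 < K"
    "\<And>b :: int \<Rightarrow> ennreal. (\<integral>\<^sup>+k. ennreal (2 powr k) * (\<Sum>i. b (k + int i)) epowr (r / q) \<partial>count_space UNIV)
       \<le> ennreal K * (\<integral>\<^sup>+k. ennreal (2 powr k) * b k epowr (r / q) \<partial>count_space UNIV)"
    by blast
  define K' where "K' = K * 2 powr r * 2 powr (r / q) * 2"
  have "0 < K'" using K(1) by (simp add: K'_def)
  show ?thesis
  proof (intro exI conjI ballI allI impI)
    show "0 < (K' * 2) powr (1 / r) + (2 powr (1 / r) + 1)"
      using \<open>0 < K'\<close> by (intro add_pos_pos) auto
    fix u v w h :: "real \<Rightarrow> ennreal" and Z x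
    assume u: "u \<in> weights" and w: "w \<in> weights" and cov: "covering_sequence u Z x"
      and h: "h \<in> nonneg_measurable"
    interpret covering_data u Z x q r w h
      using assms u w cov h by unfold_locales (auto simp: weights_def)
    have "equivalent_with ((K' * 2) powr (1 / r) + (2 powr (1 / r) + 1))
      ((\<integral>\<^sup>+y\<in>{0<..}. F y epowr (r / q) * u y \<partial>lebesgue) epowr (1 / r))
      (local_sum epowr (1 / r) + (\<integral>\<^sup>+y\<in>{0<..}. G y epowr r * u y \<partial>lebesgue) epowr (1 / r))"
      using upper_bound[OF K(2,1)] lower_bound \<open>0 < K'\<close> assms(2)
      unfolding K'_def[symmetric] by (intro equivalent_with_of_powers)
    then show "equivalent_with ((K' * 2) powr (1 / r) + (2 powr (1 / r) + 1))
        ((\<integral>\<^sup>+y\<in>{0<..}. (\<integral>\<^sup>+t\<in>{y<..}. (\<integral>\<^sup>+z\<in>{0<..<t}. h z \<partial>lebesgue) epowr q * w t \<partial>lebesgue) epowr (r / q)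
            * u y \<partial>lebesgue) epowr (1 / r))
        (lr_norm r Z (\<lambda>k. ennreal (2 powr (k / r)) *
            (\<integral>\<^sup>+t\<in>einterval (x k) (x (k + 1)).
               (\<integral>\<^sup>+z\<in>einterval (x k) (ereal t). h z \<partial>lebesgue) epowr q * w t \<partial>lebesgue) epowr (1 / q))
         + (\<integral>\<^sup>+y\<in>{0<..}. u y *
             (SUP s\<in>{y..}. (\<integral>\<^sup>+t\<in>{s<..}. w t \<partial>lebesgue) epowr (1 / q) *
                          (\<integral>\<^sup>+z\<in>{0<..<s}. h z \<partial>lebesgue)) epowr r
            \<partial>lebesgue) epowr (1 / r))"
      unfolding lr_norm_local F_def G_def H_def W_def by (simp only: mult.commute[of "u _"])
  qed
qed

end
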